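(* Let $f\in\mathcal C\setminus\{0\}$ and $T\in\mathcal A(f)$. The set of children of $T$ in the tree $G(\mathcal A(f))$ is $$\bigl\{T\cup\{x\}\mid x\in\operatorname{SG}(T)\setminus(\Lambda\cup\{f\}),\ x\prec\operatorname{m}(T),\ \text{and } x+e\notin\operatorname{N}(T)\text{ for all }e\in\Lambda\bigr\}.$$
   Context: Notation: $\mathbb N=\{0,1,2,\dots\}$, $p\ge 1$, and $\Lambda=\{e_1,\dots,e_p\}$ is the canonical basis of $\mathbb N^p$. $\mathcal C\subseteq\mathbb N^p$ is a fixed non-negative integer cone (the set of points of $\mathbb N^p$ lying in a finitely generated rational convex cone), with at least $p$ extremal rays. A $\mathcal C$-semigroup is a finitely generated submonoid $S\subseteq\mathcal C$ of $\mathbb N^p$ such that the minimal integer cone containing $S$ is $\mathcal C$ and $\mathcal H(S)=\mathcal C\setminus S$ is finite. A monomial order $\preceq$ on $\mathbb N^p$ is fixed: a total order compatible with addition with $0\preceq x$ for all $x$; it is assumed that $\{x\in\mathcal C\mid x\preceq k\}$ is finite for every $k\in\mathcal C$. $\operatorname{Fb}(S)=\max_\preceq\mathcal H(S)$ (and $-\sum_i e_i$ if $\mathcal H(S)=\emptyset$), $\operatorname{N}(S)=\{x\in S\mid x\prec\operatorname{Fb}(S)\}$, $\operatorname{m}(S)=\min_\preceq(S\setminus\{0\})$. A $\mathcal C$-semigroup $S$ is an $\mathcal A$-semigroup if for every $s\in S$ and $e\in\Lambda$ the set $\{s,s+e\}$ is not contained in $\operatorname{N}(S)$. $\mathcal A(f)$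 is the set of all $\mathcal A$-semigroups $S$ with $\operatorname{Fb}(S)=f$. $G(\mathcal A(f))$ is the directed graph with vertex set $\mathcal A(f)$ in which $(S,T)$ with $S\neq T$ is an edge if and only if $T=S\setminus\{\operatorname{m}(S)\}$; if $(S,T)$ is an edge, $S$ is called a child of $T$. The set of pseudo-Frobenius elements is $\operatorname{PF}(S)=\{x\in\mathcal H(S)\mid x+s\in S\text{ for all }s\in S\setminus\{0\}\}$, and the set of special gaps is $\operatorname{SG}(S)=\{x\in\operatorname{PF}(S)\mid 2x\in S\}$. *)

theory Defs
  imports "HOL-Analysis.Analysis" "Graph_Theory.Pair_Digraph"
begin

(* Points of N^p are vectors of type nat ^ 'p; p = CARD('p) is positive because 'p is nonempty.
   Z^p and R^p are int ^ 'p and real ^ 'p. *)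

definition of_nat_vec :: "nat ^ 'p \<Rightarrow> 'a::semiring_1 ^ 'p" where
  "of_nat_vec x = (\<chi> i. of_nat (x $ i))"

definition unit_vectors :: "(nat ^ 'p) set" where
  "unit_vectors = range (\<lambda>i. axis i 1)"

definition integer_cone :: "(nat ^ 'p) set \<Rightarrow> bool" where
  "integer_cone C \<longleftrightarrow>
     (\<exists>V :: (real ^ 'p) set. finite V \<and> (\<forall>v\<in>V. \<forall>i. v $ i \<in> \<rat>) \<and>
        C = {x. of_nat_vec x \<in> convex_cone hull V})"

(* The real cone spanned by a subset of N^p is pointed, so its one-dimensional faces
   are half-lines from the origin. *)
definition extremal_rays :: "(nat ^ 'p) set \<Rightarrow> (real ^ 'p) set set" where
  "extremal_rays C = {R. R face_of (convex_cone hull (of_nat_vec ` C)) \<and> aff_dim R = 1}"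

definition additive_submonoid :: "(nat ^ 'p) set \<Rightarrow> bool" where
  "additive_submonoid S \<longleftrightarrow> 0 \<in> S \<and> (\<forall>x\<in>S. \<forall>y\<in>S. x + y \<in> S)"

definition gaps :: "(nat ^ 'p) set \<Rightarrow> (nat ^ 'p) set \<Rightarrow> (nat ^ 'p) set" where
  "gaps C S = C - S"

(* integer_cone hull S is the intersection of all integer cones containing S. *)
definition C_semigroup :: "(nat ^ 'p) set \<Rightarrow> (nat ^ 'p) set \<Rightarrow> bool" where
  "C_semigroup C S \<longleftrightarrow>
     additive_submonoid S \<and> (\<exists>A. finite A \<and> S = additive_submonoid hull A) \<and>
     S \<subseteq> C \<and> integer_cone hull S = C \<and> finite (gaps C S)"

definition monomial_order :: "(nat ^ 'p \<Rightarrow> nat ^ 'p \<Rightarrow> bool) \<Rightarrow> bool" where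
  "monomial_order le \<longleftrightarrow>
     class.linorder le (\<lambda>x y. le x y \<and> x \<noteq> y) \<and>
     (\<forall>x y z. le x y \<longrightarrow> le (x + z) (y + z)) \<and> (\<forall>x. le 0 x)"

(* The unique extension of a monomial order to a translation-invariant order on Z^p; it is needed
   because the Frobenius element may be the vector with all entries -1. *)
definition int_le ::
  "(nat ^ 'p \<Rightarrow> nat ^ 'p \<Rightarrow> bool) \<Rightarrow> int ^ 'p \<Rightarrow> int ^ 'p \<Rightarrow> bool" where
  "int_le le u v \<longleftrightarrow>
     (\<exists>x y w. u + of_nat_vec w = of_nat_vec x \<and> v + of_nat_vec w = of_nat_vec y \<and> le x y)"

definition Fb ::
  "(nat ^ 'p \<Rightarrow> nat ^ 'p \<Rightarrow> bool) \<Rightarrow> (nat ^ 'p) set \<Rightarrow> (nat ^ 'p) set \<Rightarrow> int ^ 'p" where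
  "Fb le C S =
     (if gaps C S = {} then - (\<Sum>i\<in>UNIV. axis i 1)
      else of_nat_vec (linorder.Max le (gaps C S)))"

definition left_elements ::
  "(nat ^ 'p \<Rightarrow> nat ^ 'p \<Rightarrow> bool) \<Rightarrow> (nat ^ 'p) set \<Rightarrow> (nat ^ 'p) set \<Rightarrow> (nat ^ 'p) set" where
  "left_elements le C S =
     {x \<in> S. int_le le (of_nat_vec x) (Fb le C S) \<and> of_nat_vec x \<noteq> Fb le C S}"

definition min_nonzero :: "(nat ^ 'p \<Rightarrow> nat ^ 'p \<Rightarrow> bool) \<Rightarrow> (nat ^ 'p) set \<Rightarrow> nat ^ 'p" where
  "min_nonzero le S = ord.Least le (\<lambda>x. x \<in> S - {0})"

definition A_semigroup ::
  "(nat ^ 'p \<Rightarrow> nat ^ 'p \<Rightarrow> bool) \<Rightarrow> (nat ^ 'p) set \<Rightarrow> (nat ^ 'p) set \<Rightarrow> bool" where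
  "A_semigroup le C S \<longleftrightarrow>
     C_semigroup C S \<and>
     (\<forall>s\<in>S. \<forall>e\<in>unit_vectors. \<not> {s, s + e} \<subseteq> left_elements le C S)"

definition A_semigroups ::
  "(nat ^ 'p \<Rightarrow> nat ^ 'p \<Rightarrow> bool) \<Rightarrow> (nat ^ 'p) set \<Rightarrow> nat ^ 'p \<Rightarrow> (nat ^ 'p) set set" where
  "A_semigroups le C f = {S. A_semigroup le C S \<and> Fb le C S = of_nat_vec f}"

definition A_graph ::
  "(nat ^ 'p \<Rightarrow> nat ^ 'p \<Rightarrow> bool) \<Rightarrow> (nat ^ 'p) set \<Rightarrow> nat ^ 'p \<Rightarrow>
     (nat ^ 'p) set pair_pre_digraph" where
  "A_graph le C f =
     \<lparr> pverts = A_semigroups le C f,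
       parcs = {(S, T). S \<in> A_semigroups le C f \<and> T \<in> A_semigroups le C f \<and>
                        S \<noteq> T \<and> T = S - {min_nonzero le S}} \<rparr>"

(* Arcs point from the child to the parent. *)
definition children :: "'a pair_pre_digraph \<Rightarrow> 'a \<Rightarrow> 'a set" where
  "children G t = {s. (s, t) \<in> parcs G}"

definition pseudo_Frobenius :: "(nat ^ 'p) set \<Rightarrow> (nat ^ 'p) set \<Rightarrow> (nat ^ 'p) set" where
  "pseudo_Frobenius C S = {x \<in> gaps C S. \<forall>s\<in>S - {0}. x + s \<in> S}"

definition special_gaps :: "(nat ^ 'p) set \<Rightarrow> (nat ^ 'p) set \<Rightarrow> (nat ^ 'p) set" where
  "special_gaps C S = {x \<in> pseudo_Frobenius C S. x + x \<in> S}"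

end

theory Submission
  imports Defs
begin

text \<open>
  A child of \<open>T\<close> arises by putting back a minimal nonzero element, so the question is which
  points \<open>x\<close> of \<open>C\<close> outside \<open>T\<close> can be adjoined to \<open>T\<close> such that \<open>T \<union> {x}\<close> is again in the family and has
  minimum \<open>x\<close>.

  \<^item> The set \<open>T \<union> {x}\<close> is closed under addition exactly when \<open>x\<close> is a special gap. Finite
    generation, cofiniteness in \<open>C\<close> and the cone spanned by \<open>T\<close> then survive by themselves
    (\<open>C_semigroup_insert\<close>).
  \<^item> The Frobenius element \<open>f\<close> is kept exactly when \<open>x \<noteq> f\<close>, and \<open>x\<close> is the new minimum
    exactly when it precedes \<open>min_nonzero T\<close>. The left elements of \<open>T \<union> {x}\<close> are those of
    \<open>T\<close> together with \<open>x\<close>.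
  \<^item> A forbidden pair \<open>{s, s + e}\<close> of left elements of \<open>T \<union> {x}\<close> that is not already one of
    \<open>T\<close> has \<open>s = x\<close> or \<open>s + e = x\<close>. The condition \<open>x + e \<notin> N(T)\<close> excludes the first kind.
    In the second kind \<open>s\<close> is an element of \<open>T\<close> below its minimum, so \<open>s = 0\<close> and \<open>x = e\<close>;
    this is what \<open>x \<notin> \<Lambda>\<close> excludes. Both conditions are also necessary: \<open>{x, x + e}\<close> is
    forbidden outright, and if \<open>x\<close> is a unit vector, so is \<open>{0, 0 + x}\<close>.

  All these minima exist because initial segments of \<open>C\<close> are finite, and because a member of
  the family contains the nonzero point \<open>f + f\<close>, which lies in \<open>C\<close> beyond the nonzero
  Frobenius element \<open>f\<close>.
\<close>

section \<open>Vectors of natural numbers, integer cones and semigroups\<close>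

lemma of_nat_vec_add: "of_nat_vec (x + y) = of_nat_vec x + of_nat_vec y"
  by (simp add: of_nat_vec_def vec_eq_iff)

lemma of_nat_vec_inject [simp]:
  "(of_nat_vec x :: 'a::semiring_char_0 ^ 'p) = of_nat_vec y \<longleftrightarrow> x = y"
  by (simp add: of_nat_vec_def vec_eq_iff)

lemma integer_cone_add:
  assumes "integer_cone C" "x \<in> C" "y \<in> C"
  shows "x + y \<in> C"
proof -
  obtain V :: "(real ^ 'a) set" where C: "C = {x. of_nat_vec x \<in> convex_cone hull V}"
    using assms(1) unfolding integer_cone_def by blast
  show ?thesis
    using assms(2,3) by (simp add: C of_nat_vec_add convex_cone_hull_add)
qed

lemma additive_submonoid_insert:
  assumes "additive_submonoid T" "x \<in> special_gaps C T"
  shows "additive_submonoid (T \<union> {x})"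
  unfolding additive_submonoid_def
proof (intro conjI ballI)
  show "0 \<in> T \<union> {x}"
    using assms(1) by (simp add: additive_submonoid_def)
next
  have shift: "x + s \<in> T" if "s \<in> T" "s \<noteq> 0" for s
    using assms(2) that by (auto simp: special_gaps_def pseudo_Frobenius_def)
  have double: "x + x \<in> T"
    using assms(2) by (simp add: special_gaps_def)
  fix a b assume ab: "a \<in> T \<union> {x}" "b \<in> T \<union> {x}"
  consider "a = 0 \<or> b = 0" | "a = x" "b = x" | "a = x" "b \<in> T" "b \<noteq> 0"
    | "b = x" "a \<in> T" "a \<noteq> 0" | "a \<in> T" "b \<in> T"
    using ab by blast
  then show "a + b \<in> T \<union> {x}"
  proof cases
    case 1 then show ?thesis using ab by auto
  next
    case 2 then show ?thesis using double by simp
  next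
    case 3 then show ?thesis using shift by simp
  next
    case 4 then show ?thesis using shift by (simp add: add.commute)
  next
    case 5 then show ?thesis using assms(1) by (simp add: additive_submonoid_def)
  qed
qed

text \<open>
  Once \<open>T \<union> {x}\<close> is closed under addition, it is generated by the generators of \<open>T\<close> and \<open>x\<close>.
  Its cone is squeezed between the cone of \<open>T\<close> and \<open>C\<close>, which coincide.
\<close>
lemma C_semigroup_insert:
  assumes "integer_cone C" "C_semigroup C T" "x \<in> special_gaps C T"
  shows "C_semigroup C (T \<union> {x})"
proof -
  obtain A where "finite A" and T_gen: "T = additive_submonoid hull A"
    using assms(2) unfolding C_semigroup_def by blast
  have "x \<in> C" and "T \<subseteq> C"
    using assms by (auto simp: C_semigroup_def special_gaps_def pseudo_Frobenius_def gaps_def)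
  have monoid: "additive_submonoid (T \<union> {x})"
    using assms additive_submonoid_insert by (auto simp: C_semigroup_def)
  have "T \<union> {x} = additive_submonoid hull (insert x A)"
  proof
    have "T \<subseteq> additive_submonoid hull (insert x A)"
      unfolding T_gen by (intro hull_mono) blast
    then show "T \<union> {x} \<subseteq> additive_submonoid hull (insert x A)"
      by (simp add: hull_inc)
    show "additive_submonoid hull (insert x A) \<subseteq> T \<union> {x}"
      using hull_subset[of A additive_submonoid] monoid by (intro hull_minimal) (auto simp: T_gen)
  qed
  moreover have "integer_cone hull (T \<union> {x}) = C"
  proof
    show "integer_cone hull (T \<union> {x}) \<subseteq> C"
      using \<open>x \<in> C\<close> \<open>T \<subseteq> C\<close> assms(1) by (intro hull_minimal) auto
    have "C = integer_cone hull T"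
      using assms(2) by (simp add: C_semigroup_def)
    then show "C \<subseteq> integer_cone hull (T \<union> {x})"
      using hull_mono[of T "T \<union> {x}" integer_cone] by blast
  qed
  moreover have "finite (gaps C (T \<union> {x}))"
    using assms(2) finite_subset[of "gaps C (T \<union> {x})" "gaps C T"]
    by (auto simp: C_semigroup_def gaps_def)
  ultimately show ?thesis
    using monoid \<open>finite A\<close> \<open>x \<in> C\<close> \<open>T \<subseteq> C\<close> unfolding C_semigroup_def
    by (metis Un_insert_right finite_insert insert_subset sup_bot_right)
qed

section \<open>Frobenius elements, left elements and minima under a monomial order\<close>

locale monomial_order_on_cone =
  fixes le :: "nat ^ 'p \<Rightarrow> nat ^ 'p \<Rightarrow> bool" (infix "\<preceq>" 50)
    and C :: "(nat ^ 'p) set"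
  assumes monomial: "monomial_order (\<preceq>)"
    and cone: "integer_cone C"
    and finite_below: "k \<in> C \<Longrightarrow> finite {x \<in> C. x \<preceq> k}"
begin

sublocale linorder "(\<preceq>)" "\<lambda>x y. x \<preceq> y \<and> x \<noteq> y"
  using monomial by (simp add: monomial_order_def)

lemma add_right_mono: "x \<preceq> y \<Longrightarrow> x + z \<preceq> y + z"
  using monomial by (simp add: monomial_order_def)

lemma zero_le: "0 \<preceq> x"
  using monomial by (simp add: monomial_order_def)

lemma le_add: "x \<preceq> x + y"
  using add_right_mono[of 0 y x, OF zero_le] by (simp add: add.commute)

text \<open>
  A translation-invariant total order is cancellative, so the extension to integer vectors
  restricts to the given order.
\<close>
lemma int_le_of_nat_vec: "int_le (\<preceq>) (of_nat_vec x) (of_nat_vec y) \<longleftrightarrow> x \<preceq> y"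
proof
  assume "int_le (\<preceq>) (of_nat_vec x) (of_nat_vec y)"
  then obtain w where "x + w \<preceq> y + w"
    by (auto simp: int_le_def simp flip: of_nat_vec_add)
  then show "x \<preceq> y"
    using add_right_mono[of y x w] order.antisym[of "x + w" "y + w"] linear[of x y] by auto
next
  assume "x \<preceq> y"
  then show "int_le (\<preceq>) (of_nat_vec x) (of_nat_vec y)"
    by (auto simp: int_le_def simp flip: of_nat_vec_add intro!: exI[of _ 0])
qed

lemma Fb_eq_iff:
  assumes "finite (gaps C S)"
  shows "Fb (\<preceq>) C S = of_nat_vec f \<longleftrightarrow> f \<in> gaps C S \<and> (\<forall>y\<in>gaps C S. y \<preceq> f)"
proof (cases "gaps C S = {}")
  case True
  \<comment> \<open>The conventional value has negative entries, so it is not a point of \<open>\<nat>\<^sup>p\<close>.\<close>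
  have "- (\<Sum>i\<in>UNIV. axis i 1) \<noteq> (of_nat_vec f :: int ^ 'p)"
  proof
    assume *: "- (\<Sum>i\<in>UNIV. axis i 1) = (of_nat_vec f :: int ^ 'p)"
    have "(- (\<Sum>i\<in>UNIV. axis i 1) :: int ^ 'p) $ j = - 1" for j
      by (simp add: axis_def)
    then show False
      unfolding * by (simp add: of_nat_vec_def)
  qed
  then show ?thesis
    using True by (simp add: Fb_def)
next
  case False
  then show ?thesis
    using assms Max_eq_iff[of "gaps C S" f] by (simp add: Fb_def)
qed

lemma left_elements_eq:
  assumes "Fb (\<preceq>) C S = of_nat_vec f"
  shows "left_elements (\<preceq>) C S = {x \<in> S. x \<preceq> f \<and> x \<noteq> f}"
  using assms by (simp add: left_elements_def int_le_of_nat_vec)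

lemma min_nonzero_eqI:
  assumes "x \<in> S" "x \<noteq> 0" "\<And>y. y \<in> S \<Longrightarrow> y \<noteq> 0 \<Longrightarrow> x \<preceq> y"
  shows "min_nonzero (\<preceq>) S = x"
  unfolding min_nonzero_def using assms by (intro Least_equality) auto

text \<open>
  The minimum exists because below any nonzero \<open>k \<in> S\<close> there are only finitely many
  candidates for it.
\<close>
lemma min_nonzero:
  assumes "S \<subseteq> C" "k \<in> S" "k \<noteq> 0"
  shows "min_nonzero (\<preceq>) S \<in> S - {0}"
    and "y \<in> S \<Longrightarrow> y \<noteq> 0 \<Longrightarrow> min_nonzero (\<preceq>) S \<preceq> y"
proof -
  let ?B = "{x \<in> S - {0}. x \<preceq> k}"
  have fin: "finite ?B"
    using finite_below[of k] assms by (auto intro: finite_subset[rotated])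
  have "k \<in> ?B"
    using assms by simp
  then have mem: "Min ?B \<in> ?B"
    using Min_in[OF fin] by blast
  have below: "Min ?B \<preceq> y" if "y \<in> S" "y \<noteq> 0" for y
  proof (cases "y \<preceq> k")
    case True
    then show ?thesis using Min_le[OF fin] that by simp
  next
    case False
    then show ?thesis using mem linear[of y k] order_trans[of "Min ?B" k y] by blast
  qed
  have "min_nonzero (\<preceq>) S = Min ?B"
    using mem below by (intro min_nonzero_eqI) auto
  then show "min_nonzero (\<preceq>) S \<in> S - {0}"
    and "y \<in> S \<Longrightarrow> y \<noteq> 0 \<Longrightarrow> min_nonzero (\<preceq>) S \<preceq> y"
    using mem below by auto
qed

lemma A_semigroups_iff:
  "S \<in> A_semigroups (\<preceq>) C f \<longleftrightarrow>
     C_semigroup C S \<and> f \<in> gaps C S \<and> (\<forall>y\<in>gaps C S. y \<preceq> f) \<and>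
     (\<forall>s\<in>S. \<forall>e\<in>unit_vectors. \<not> {s, s + e} \<subseteq> {x \<in> S. x \<preceq> f \<and> x \<noteq> f})"
proof (cases "C_semigroup C S \<and> Fb (\<preceq>) C S = of_nat_vec f")
  case True
  then have max: "f \<in> gaps C S \<and> (\<forall>y\<in>gaps C S. y \<preceq> f)"
    using Fb_eq_iff[of S f] by (simp add: C_semigroup_def)
  have left: "left_elements (\<preceq>) C S = {x \<in> S. x \<preceq> f \<and> x \<noteq> f}"
    using True by (simp add: left_elements_eq)
  show ?thesis
    using True max unfolding A_semigroups_def A_semigroup_def mem_Collect_eq left by argo
next
  case False
  then show ?thesis
    using Fb_eq_iff[of S f] by (auto simp: A_semigroups_def A_semigroup_def C_semigroup_def)
qed

lemma left_elements_A_semigroups: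
  "S \<in> A_semigroups (\<preceq>) C f \<Longrightarrow> left_elements (\<preceq>) C S = {x \<in> S. x \<preceq> f \<and> x \<noteq> f}"
  by (simp add: A_semigroups_def left_elements_eq)

text \<open>A cone is closed under doubling, and no gap lies beyond the Frobenius element.\<close>
lemma double_Frobenius_mem:
  assumes "S \<in> A_semigroups (\<preceq>) C f" "f \<noteq> 0"
  shows "f + f \<in> S" "f + f \<noteq> 0"
proof -
  have "f \<in> C" and max: "\<forall>y\<in>gaps C S. y \<preceq> f"
    using assms(1) by (auto simp: A_semigroups_iff gaps_def)
  have "f + f \<noteq> f"
    using assms(2) by simp
  then have "\<not> f + f \<preceq> f"
    using order.antisym[OF le_add[of f f]] by auto
  then show "f + f \<in> S"
    using max integer_cone_add[OF cone \<open>f \<in> C\<close> \<open>f \<in> C\<close>] by (auto simp: gaps_def)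
  show "f + f \<noteq> 0"
    using assms(2) by (auto simp: vec_eq_iff)
qed

lemma min_nonzero_A_semigroups:
  assumes "S \<in> A_semigroups (\<preceq>) C f" "f \<noteq> 0"
  shows "min_nonzero (\<preceq>) S \<in> S - {0}"
    and "y \<in> S \<Longrightarrow> y \<noteq> 0 \<Longrightarrow> min_nonzero (\<preceq>) S \<preceq> y"
proof -
  have "S \<subseteq> C"
    using assms(1) by (simp add: A_semigroups_iff C_semigroup_def)
  note min_nonzero[OF this double_Frobenius_mem[OF assms]]
  then show "min_nonzero (\<preceq>) S \<in> S - {0}"
    and "y \<in> S \<Longrightarrow> y \<noteq> 0 \<Longrightarrow> min_nonzero (\<preceq>) S \<preceq> y" by auto
qed

section \<open>Removing the minimum and adjoining a special gap\<close>

lemma remove_min_nonzero: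
  fixes S defines "x \<equiv> min_nonzero (\<preceq>) S"
  assumes "f \<noteq> 0" "S \<in> A_semigroups (\<preceq>) C f" "T \<in> A_semigroups (\<preceq>) C f" "T = S - {x}"
  shows "x \<in> special_gaps C T - (unit_vectors \<union> {f})"
    and "x \<preceq> min_nonzero (\<preceq>) T \<and> x \<noteq> min_nonzero (\<preceq>) T"
    and "\<forall>e\<in>unit_vectors. x + e \<notin> left_elements (\<preceq>) C T"
proof -
  have "x \<in> S" "x \<noteq> 0" and min: "\<And>y. y \<in> S \<Longrightarrow> y \<noteq> 0 \<Longrightarrow> x \<preceq> y"
    using min_nonzero_A_semigroups[OF assms(3,2)] by (auto simp: x_def)
  have S: "additive_submonoid S" "S \<subseteq> C" "f \<notin> S"
    and pair: "\<And>s e. s \<in> S \<Longrightarrow> e \<in> unit_vectors \<Longrightarrow> \<not> {s, s + e} \<subseteq> {y \<in> S. y \<preceq> f \<and> y \<noteq> f}"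
    using assms(3) by (auto simp: A_semigroups_iff C_semigroup_def gaps_def)
  have zero: "0 \<in> S" and add: "\<And>a b. a \<in> S \<Longrightarrow> b \<in> S \<Longrightarrow> a + b \<in> S"
    using S(1) by (auto simp: additive_submonoid_def)
  have "x \<noteq> f"
    using \<open>x \<in> S\<close> \<open>f \<notin> S\<close> by blast
  \<comment> \<open>The point \<open>x\<close> is a gap of \<open>T\<close>, whose largest gap is \<open>f\<close>; so \<open>x\<close> is a left element of \<open>S\<close>.\<close>
  have gap: "x \<in> gaps C T"
    using \<open>x \<in> S\<close> S(2) assms(5) by (auto simp: gaps_def)
  then have "x \<preceq> f"
    using assms(4) by (simp add: A_semigroups_iff)
  have "x \<in> special_gaps C T"
    using gap add \<open>x \<in> S\<close> \<open>x \<noteq> 0\<close> assms(5)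
    by (auto simp: special_gaps_def pseudo_Frobenius_def)
  moreover have "x \<notin> unit_vectors"
  proof
    assume "x \<in> unit_vectors"
    \<comment> \<open>Then \<open>0\<close> and \<open>0 + x\<close> would be a forbidden pair of left elements of \<open>S\<close>.\<close>
    from pair[OF zero this] show False
      using \<open>x \<in> S\<close> \<open>x \<preceq> f\<close> \<open>x \<noteq> f\<close> \<open>f \<noteq> 0\<close> zero zero_le by auto
  qed
  ultimately show "x \<in> special_gaps C T - (unit_vectors \<union> {f})"
    using \<open>x \<noteq> f\<close> by blast
  show "x \<preceq> min_nonzero (\<preceq>) T \<and> x \<noteq> min_nonzero (\<preceq>) T"
    using min_nonzero_A_semigroups(1)[OF assms(4,2)] min assms(5) by auto
  show "\<forall>e\<in>unit_vectors. x + e \<notin> left_elements (\<preceq>) C T"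
    using pair[OF \<open>x \<in> S\<close>] \<open>x \<in> S\<close> \<open>x \<preceq> f\<close> \<open>x \<noteq> f\<close>
    unfolding left_elements_A_semigroups[OF assms(4)] by (auto simp: assms(5))
qed

lemma adjoin_special_gap:
  assumes "f \<noteq> 0" "T \<in> A_semigroups (\<preceq>) C f"
    and x: "x \<in> special_gaps C T - (unit_vectors \<union> {f})"
    and below: "x \<preceq> min_nonzero (\<preceq>) T" "x \<noteq> min_nonzero (\<preceq>) T"
    and no_pair: "\<forall>e\<in>unit_vectors. x + e \<notin> left_elements (\<preceq>) C T"
  shows "T \<union> {x} \<in> A_semigroups (\<preceq>) C f"
    and "min_nonzero (\<preceq>) (T \<union> {x}) = x"
proof -
  have T: "C_semigroup C T" "f \<in> gaps C T" "\<forall>y\<in>gaps C T. y \<preceq> f" "0 \<in> T"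
    and pair: "\<And>s e. s \<in> T \<Longrightarrow> e \<in> unit_vectors \<Longrightarrow> \<not> {s, s + e} \<subseteq> {y \<in> T. y \<preceq> f \<and> y \<noteq> f}"
    using assms(2) by (auto simp: A_semigroups_iff C_semigroup_def additive_submonoid_def)
  have x_props: "x \<in> gaps C T" "x \<notin> unit_vectors" "x \<noteq> f"
    using x by (auto simp: special_gaps_def pseudo_Frobenius_def)
  then have "x \<notin> T" "x \<noteq> 0"
    using T(4) by (auto simp: gaps_def)
  have min: "x \<preceq> y" if "y \<in> T" "y \<noteq> 0" for y
    using min_nonzero_A_semigroups(2)[OF assms(2,1) that] below(1) order_trans by blast
  show "min_nonzero (\<preceq>) (T \<union> {x}) = x"
    using min \<open>x \<noteq> 0\<close> by (intro min_nonzero_eqI) auto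
  have unit_nonzero: "e \<noteq> 0" if "e \<in> unit_vectors" for e :: "nat ^ 'p"
    using that by (auto simp: unit_vectors_def axis_eq_0_iff)
  have "\<not> {s, s + e} \<subseteq> {y \<in> T \<union> {x}. y \<preceq> f \<and> y \<noteq> f}"
    if "s \<in> T \<union> {x}" and e: "e \<in> unit_vectors" for s e
  proof
    assume sub: "{s, s + e} \<subseteq> {y \<in> T \<union> {x}. y \<preceq> f \<and> y \<noteq> f}"
    consider "s \<in> T" "s + e \<in> T" | "s = x" "s + e \<in> T" | "s = x" "s + e = x" | "s \<in> T" "s + e = x"
      using sub by blast
    then show False
    proof cases
      case 1
      then show ?thesis using pair[OF _ e] sub by auto
    next
      case 2
      then show ?thesis
        using no_pair e sub by (auto simp: left_elements_A_semigroups[OF assms(2)])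
    next
      case 3
      then show ?thesis using unit_nonzero[OF e] by simp
    next
      case 4
      \<comment> \<open>Here \<open>s \<preceq> s + e = x\<close>, while \<open>x\<close> precedes every nonzero element of \<open>T\<close>.\<close>
      then have "s = 0"
        using le_add[of s e] min[of s] order.antisym[of s x] \<open>x \<notin> T\<close> by metis
      then show ?thesis using 4 e x_props(2) by simp
    qed
  qed
  moreover have "C_semigroup C (T \<union> {x})"
    using C_semigroup_insert[OF cone T(1)] x by blast
  ultimately show "T \<union> {x} \<in> A_semigroups (\<preceq>) C f"
    using T x_props(3) unfolding A_semigroups_iff by (auto simp: gaps_def)
qed

end

theorem proposition4:
  fixes le :: "nat ^ 'p \<Rightarrow> nat ^ 'p \<Rightarrow> bool" (infix "\<preceq>" 50)
    and C T :: "(nat ^ 'p) set"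
    and f :: "nat ^ 'p"
  assumes "integer_cone C"
    and "CARD('p) \<le> card (extremal_rays C)"
    and "monomial_order (\<preceq>)"
    and "\<forall>k\<in>C. finite {x \<in> C. x \<preceq> k}"
    and "f \<in> C - {0}"
    and "T \<in> A_semigroups (\<preceq>) C f"
  shows "children (A_graph (\<preceq>) C f) T =
    {T \<union> {x} | x. x \<in> special_gaps C T - (unit_vectors \<union> {f}) \<and>
                   (x \<preceq> min_nonzero (\<preceq>) T \<and> x \<noteq> min_nonzero (\<preceq>) T) \<and>
                   (\<forall>e\<in>unit_vectors. x + e \<notin> left_elements (\<preceq>) C T)}"
proof -
  interpret monomial_order_on_cone "(\<preceq>)" C
    using assms by unfold_locales auto
  have "f \<noteq> 0"
    using assms(5) by simp
  show ?thesis
  proof (intro equalityI subsetI)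
    fix S assume "S \<in> children (A_graph (\<preceq>) C f) T"
    then have S: "S \<in> A_semigroups (\<preceq>) C f" "T = S - {min_nonzero (\<preceq>) S}"
      by (auto simp: children_def A_graph_def)
    note remove_min_nonzero[OF \<open>f \<noteq> 0\<close> S(1) assms(6) S(2)]
    moreover have "S = T \<union> {min_nonzero (\<preceq>) S}"
      using S(2) min_nonzero_A_semigroups(1)[OF S(1) \<open>f \<noteq> 0\<close>] by blast
    ultimately show "S \<in> {T \<union> {x} | x. x \<in> special_gaps C T - (unit_vectors \<union> {f}) \<and>
        (x \<preceq> min_nonzero (\<preceq>) T \<and> x \<noteq> min_nonzero (\<preceq>) T) \<and>
        (\<forall>e\<in>unit_vectors. x + e \<notin> left_elements (\<preceq>) C T)}"
      by blast
  next
    fix S assume "S \<in> {T \<union> {x} | x. x \<in> special_gaps C T - (unit_vectors \<union> {f}) \<and>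
        (x \<preceq> min_nonzero (\<preceq>) T \<and> x \<noteq> min_nonzero (\<preceq>) T) \<and>
        (\<forall>e\<in>unit_vectors. x + e \<notin> left_elements (\<preceq>) C T)}"
    then obtain x where S: "S = T \<union> {x}"
      and x: "x \<in> special_gaps C T - (unit_vectors \<union> {f})"
        "x \<preceq> min_nonzero (\<preceq>) T" "x \<noteq> min_nonzero (\<preceq>) T"
        "\<forall>e\<in>unit_vectors. x + e \<notin> left_elements (\<preceq>) C T"
      by blast
    have "x \<notin> T"
      using x(1) by (auto simp: special_gaps_def pseudo_Frobenius_def gaps_def)
    then show "S \<in> children (A_graph (\<preceq>) C f) T"
      using adjoin_special_gap[OF \<open>f \<noteq> 0\<close> assms(6) x] assms(6) S
      by (auto simp: children_def A_graph_def)
  qed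
qed

end
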